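(* Let $X$ be a Euclidean space, $E:=X\times\mathbb{R}$, and let $f:X\to\,]-\infty,+\infty]$ be a proper function with closed graph. Put $B:=\operatorname{gra} f=\{(y,f(y)) : y\in\operatorname{dom} f\}$ and $A:=X\times\{0\}$. Let $D\subset\operatorname{dom} f$ be nonempty and convex, let $f$ be Lipschitz continuous on $D$, and let $F:D\to\,]-\infty,+\infty]$ be convex and such that for all $y\in D$ $$\partial F(y)\supset\begin{cases}\left\{\frac{f(y)}{\|y^*\|^2}y^* : y^*\in\partial^0 f(y)\right\} & \text{if } 0\notin\partial^0 f(y),\\ \{0\} & \text{if } f(y)=0.\end{cases}$$ Let $V(y,\rho):=F(y)+\tfrac12\rho^2$ on $U:=D\times\mathbb{R}$. Suppose that for all $y\in D$, $0\in\partial^0 f(y)$ implies $f(y)=0$; that $P_B$ is single-valued on $U$; and that $T_{A,B}$ maps $U$ into $U$. If $V$ is a smooth Lyapunov function on $U$ with respect to some $(\omega_1,\omega_2)$ for $x^+=T_{A,B}x$ and $\langle\nabla V(x^+),x-x^+\rangle=0$ for all $x\in U$ (with $x^+=T_{A,B}x$), then $\mathcal{C}_{T_{A,B}}\in\mathbf{MCS}(V)$ (for $T=T_{A,B}$) with $\Lambda=R_A$ and $\psi=P_A$. If $V$ is a smooth Lyapunov function on $U$ with respect to some $(\omega_1,\omega_2)$ for $x^+=T_{B,A}x$ and $\langle\nabla V(x^+),x-x^+\rangle=0$ for all $x\in U$ (with $x^+=T_{B,A}x$), then $\mathcal{C}_{T_{B,A}}\in\mathbf{MCS}(V)$ (for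 $T=T_{B,A}$) with $\Lambda=R_B$ and $\psi=P_B$.
   Context: Euclidean space means finite-dimensional real inner product space. $P_S$ denotes (a selection of) the nearest-point projection onto $S$, $R_S:=2P_S-\mathrm{Id}$, $T_{A,B}:=\tfrac12R_BR_A+\tfrac12\mathrm{Id}$, $T_{B,A}:=\tfrac12R_AR_B+\tfrac12\mathrm{Id}$. $H(y,z):=\frac{y+z}{2}+\{y-z\}^\perp$. $C(a,b,c)$ is the circumcenter of $a,b,c$: the point of $\operatorname{aff}\{a,b,c\}$ equidistant from $a,b,c$. The circumcentered-reflection operator is $$\mathcal{C}_{T_{A,B}}x:=\begin{cases}T_{A,B}x&\text{if }x,R_Ax,R_BR_Ax\text{ are colinear},\\ C(x,R_Ax,R_BR_Ax)&\text{otherwise},\end{cases}$$ and $\mathcal{C}_{T_{B,A}}$ is defined the same way with $A$ and $B$ exchanged. $\partial f$ denotes the limiting (Mordukhovich) subdifferential, $\partial^0 f(y):=\partial f(y)\cup(-\partial(-f)(y))$; $\partial F$ is the convex subdifferential ($F$ extended by $+\infty$ outside $D$). Lyapunov function: for $T:U\rightrightarrows U$ and continuous $\omega_1,\omega_2:E\to\mathbb{R}_+$, $V:U\to\mathbb{R}_+$ is a Lyapunov function with respect to $(\omega_1,\omega_2)$ on $U$ for $x^+\in Tx$ if there are continuous, zero-at-zero, monotone increasing, unbounded $\alpha_1,\alpha_2:\mathbb{R}_+\to\mathbb{R}_+$ such that for all $x\in U$: $\alpha_1(\omega_1(x))\le V(x)\le\alpha_2(\omega_2(x))$; $\sup_{x^+\in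 Tx}V(x^+)\le V(x)e^{-1}$; and $V(x)=0\iff x\in\mathcal{A}$, where $\mathcal{A}$ is the set of $\xi\in U$ such that $\omega_1(\varphi(k))=0$ for every $k\in\mathbb{N}$ and every sequence $\varphi$ with $\varphi(0)=\xi$ and $\varphi(j+1)\in T(\varphi(j))$ for all $j$. $\mathbf{MCS}(V)$: given $V$ a smooth Lyapunov function on $U$ for $x^+\in Tx$, $\Omega_T\in\mathbf{MCS}(V)$ with maps $\Lambda,\psi$ if for all $x\in U$ $$\Omega_Tx=\begin{cases}C(x,2x^+-x,\Lambda x)&\text{if }x,2x^+-x,\Lambda x\text{ are not colinear},\\ x^+&\text{otherwise},\end{cases}$$ $\psi x\in H(x,\Lambda x)\cap\operatorname{aff}\{x,2x^+-x,\Lambda x\}$, $\;x^++\mathbb{R}\nabla V(x^+)\subset H(x,2x^+-x)$, and $\psi x+\mathbb{R}\nabla V(\psi x)\subset H(\Lambda x,x)$ (with $\psi x\in U$). *)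

theory Defs
  imports "HOL-Analysis.Analysis"
begin

text \<open>
  The sort \<open>{real_inner, heine_borel}\<close> denotes exactly the finite-dimensional real inner product
  spaces; unlike \<open>euclidean_space\<close> it does not exclude the trivial one.
\<close>

definition edom :: "('a \<Rightarrow> ereal) \<Rightarrow> 'a set" where
  "edom f = {y. f y \<noteq> \<infinity>}"

definition proper :: "('a \<Rightarrow> ereal) \<Rightarrow> bool" where
  "proper f \<longleftrightarrow> (\<forall>y. f y \<noteq> -\<infinity>) \<and> edom f \<noteq> {}"

definition gra :: "('a \<Rightarrow> ereal) \<Rightarrow> ('a \<times> real) set" where
  "gra f = {(y, r). f y = ereal r}"

text \<open>Intended for functions that omit the value \<open>-\<infinity>\<close> on \<open>D\<close>; note that \<open>0 * \<infinity> = 0\<close> in \<open>ereal\<close>.\<close>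

definition convex_on_ereal :: "'a::real_vector set \<Rightarrow> ('a \<Rightarrow> ereal) \<Rightarrow> bool" where
  "convex_on_ereal D F \<longleftrightarrow> convex D \<and>
     (\<forall>x\<in>D. \<forall>y\<in>D. \<forall>u\<ge>0. \<forall>v\<ge>0. u + v = 1 \<longrightarrow>
        F (u *\<^sub>R x + v *\<^sub>R y) \<le> ereal u * F x + ereal v * F y)"

definition frechet_subdiff :: "('a::real_inner \<Rightarrow> ereal) \<Rightarrow> 'a \<Rightarrow> 'a set" where
  "frechet_subdiff f x = {v. \<bar>f x\<bar> \<noteq> \<infinity> \<and>
     0 \<le> Liminf (at x) (\<lambda>z. (f z - f x - ereal (v \<bullet> (z - x))) / ereal (norm (z - x)))}"

definition limiting_subdiff :: "('a::real_inner \<Rightarrow> ereal) \<Rightarrow> 'a \<Rightarrow> 'a set" where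
  "limiting_subdiff f x = {v. \<bar>f x\<bar> \<noteq> \<infinity> \<and>
     (\<exists>xs vs. xs \<longlonglongrightarrow> x \<and> (\<lambda>n. f (xs n)) \<longlonglongrightarrow> f x \<and>
        (\<forall>n. vs n \<in> frechet_subdiff f (xs n)) \<and> vs \<longlonglongrightarrow> v)}"

definition symmetric_subdiff :: "('a::real_inner \<Rightarrow> ereal) \<Rightarrow> 'a \<Rightarrow> 'a set" where
  "symmetric_subdiff f x = limiting_subdiff f x \<union> uminus ` limiting_subdiff (\<lambda>z. - f z) x"

definition convex_subdiff :: "'a::real_inner set \<Rightarrow> ('a \<Rightarrow> ereal) \<Rightarrow> 'a \<Rightarrow> 'a set" where
  "convex_subdiff D F y =
     (let F' = (\<lambda>z. if z \<in> D then F z else \<infinity>)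
      in {v. \<bar>F' y\<bar> \<noteq> \<infinity> \<and> (\<forall>z. F' y + ereal (v \<bullet> (z - y)) \<le> F' z)})"

text \<open>\<^const>\<open>closest_point\<close> serves as the selection of the nearest-point projection.\<close>

definition reflector :: "'a::{real_inner,heine_borel} set \<Rightarrow> 'a \<Rightarrow> 'a" where
  "reflector S x = 2 *\<^sub>R closest_point S x - x"

text \<open>\<open>douglas_rachford A B\<close> is \<open>T\<^sub>A\<^sub>,\<^sub>B\<close>: it reflects in \<open>A\<close> first.\<close>

definition douglas_rachford ::
    "'a::{real_inner,heine_borel} set \<Rightarrow> 'a set \<Rightarrow> 'a \<Rightarrow> 'a" where
  "douglas_rachford A B x = (1/2) *\<^sub>R reflector B (reflector A x) + (1/2) *\<^sub>R x"

definition circumcenter :: "'a::real_inner \<Rightarrow> 'a \<Rightarrow> 'a \<Rightarrow> 'a" where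
  "circumcenter a b c = (THE p. p \<in> affine hull {a, b, c} \<and> dist p a = dist p b \<and> dist p b = dist p c)"

definition circumcentered_reflection ::
    "'a::{real_inner,heine_borel} set \<Rightarrow> 'a set \<Rightarrow> 'a \<Rightarrow> 'a" where
  "circumcentered_reflection A B x =
     (if collinear {x, reflector A x, reflector B (reflector A x)}
      then douglas_rachford A B x
      else circumcenter x (reflector A x) (reflector B (reflector A x)))"

definition bisector :: "'a::real_inner \<Rightarrow> 'a \<Rightarrow> 'a set" where
  "bisector y z = (\<lambda>w. (1/2) *\<^sub>R (y + z) + w) ` orthogonal_comp {y - z}"

definition comparison_fun :: "(real \<Rightarrow> real) \<Rightarrow> bool" where
  "comparison_fun \<alpha> \<longleftrightarrow> continuous_on {0..} \<alpha> \<and> \<alpha> 0 = 0 \<and> mono_on {0..} \<alpha> \<and> \<not> bdd_above (\<alpha> ` {0..})"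

definition attracted_set :: "('e \<Rightarrow> real) \<Rightarrow> 'e set \<Rightarrow> ('e \<Rightarrow> 'e set) \<Rightarrow> 'e set" where
  "attracted_set \<omega> U T =
     {\<xi>\<in>U. \<forall>\<phi>. \<phi> 0 = \<xi> \<and> (\<forall>j. \<phi> (Suc j) \<in> T (\<phi> j)) \<longrightarrow> (\<forall>k::nat. \<omega> (\<phi> k) = 0)}"

definition lyapunov ::
    "('e::topological_space \<Rightarrow> real) \<Rightarrow> ('e \<Rightarrow> real) \<Rightarrow> 'e set \<Rightarrow> ('e \<Rightarrow> 'e set) \<Rightarrow> ('e \<Rightarrow> real) \<Rightarrow> bool" where
  "lyapunov \<omega>\<^sub>1 \<omega>\<^sub>2 U T V \<longleftrightarrow>
     continuous_on UNIV \<omega>\<^sub>1 \<and> (\<forall>x. 0 \<le> \<omega>\<^sub>1 x) \<and>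
     continuous_on UNIV \<omega>\<^sub>2 \<and> (\<forall>x. 0 \<le> \<omega>\<^sub>2 x) \<and>
     (\<forall>x\<in>U. T x \<subseteq> U) \<and> (\<forall>x\<in>U. 0 \<le> V x) \<and>
     (\<exists>\<alpha>\<^sub>1 \<alpha>\<^sub>2. comparison_fun \<alpha>\<^sub>1 \<and> comparison_fun \<alpha>\<^sub>2 \<and>
        (\<forall>x\<in>U. \<alpha>\<^sub>1 (\<omega>\<^sub>1 x) \<le> V x \<and> V x \<le> \<alpha>\<^sub>2 (\<omega>\<^sub>2 x) \<and>
           (SUP x'\<in>T x. ereal (V x')) \<le> ereal (V x * exp (-1)) \<and>
           (V x = 0 \<longleftrightarrow> x \<in> attracted_set \<omega>\<^sub>1 U T)))"

text \<open>
  \<open>V\<close> is continuously differentiable on \<open>U\<close> with gradient field \<open>G\<close>. As \<open>V\<close> lives on \<open>U\<close> only,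
  derivatives are taken within \<open>U\<close>; at interior points of \<open>U\<close> this is the ordinary gradient.
\<close>

definition has_gradient_on ::
    "('e::real_inner \<Rightarrow> real) \<Rightarrow> ('e \<Rightarrow> 'e) \<Rightarrow> 'e set \<Rightarrow> bool" where
  "has_gradient_on V G U \<longleftrightarrow> continuous_on U G \<and>
     (\<forall>x\<in>U. (V has_derivative (\<lambda>h. G x \<bullet> h)) (at x within U))"

definition smooth_lyapunov ::
    "'e::real_inner set \<Rightarrow> ('e \<Rightarrow> 'e) \<Rightarrow> ('e \<Rightarrow> real) \<Rightarrow> ('e \<Rightarrow> 'e) \<Rightarrow> bool" where
  "smooth_lyapunov U T V G \<longleftrightarrow>
     (\<exists>\<omega>\<^sub>1 \<omega>\<^sub>2. lyapunov \<omega>\<^sub>1 \<omega>\<^sub>2 U (\<lambda>x. {T x}) V) \<and> has_gradient_on V G U"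

text \<open>
  The operators \<open>\<Omega>\<close> in \<open>MCS(V)\<close> with maps \<open>\<Lambda>\<close> and \<open>\<psi>\<close>, for the dynamics \<open>x\<^sup>+ = T x\<close> on \<open>U\<close> and
  \<open>G = \<nabla>V\<close>.
\<close>

definition MCS ::
    "'e::real_inner set \<Rightarrow> ('e \<Rightarrow> 'e) \<Rightarrow> ('e \<Rightarrow> real) \<Rightarrow> ('e \<Rightarrow> 'e) \<Rightarrow> ('e \<Rightarrow> 'e) \<Rightarrow> ('e \<Rightarrow> 'e) \<Rightarrow>
     ('e \<Rightarrow> 'e) set" where
  "MCS U T V G \<Lambda> \<psi> =
     {\<Omega>. smooth_lyapunov U T V G \<and>
       (\<forall>x\<in>U.
          \<Omega> x = (if \<not> collinear {x, 2 *\<^sub>R T x - x, \<Lambda> x}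
                 then circumcenter x (2 *\<^sub>R T x - x) (\<Lambda> x) else T x) \<and>
          \<psi> x \<in> U \<and>
          \<psi> x \<in> bisector x (\<Lambda> x) \<inter> affine hull {x, 2 *\<^sub>R T x - x, \<Lambda> x} \<and>
          range (\<lambda>t. T x + t *\<^sub>R G (T x)) \<subseteq> bisector x (2 *\<^sub>R T x - x) \<and>
          range (\<lambda>t. \<psi> x + t *\<^sub>R G (\<psi> x)) \<subseteq> bisector (\<Lambda> x) x)}"

end

theory Submission
  imports Defs
begin

text \<open>
  Membership in \<open>MCS(V)\<close> reduces to \<open>\<langle>\<nabla>V(P x), x - P x\<rangle> = 0\<close>, where \<open>P\<close> projects onto the set reflected
  in first. For \<open>P\<^sub>A\<close> this says that \<open>\<partial>V/\<partial>\<rho>\<close> vanishes at \<open>\<rho> = 0\<close>. For \<open>P\<^sub>B\<close>, let \<open>P\<^sub>B (u, \<rho>) = (y, r)\<close>;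
  then \<open>T\<^sub>B\<^sub>,\<^sub>A (u, \<rho>) = (y, \<rho> - r)\<close>. As \<open>V\<close> is a sum of a function of \<open>y\<close> and \<open>\<rho>\<^sup>2/2\<close>, its derivative
  in the direction \<open>(u - y, 0)\<close> has the same value \<open>g\<close> at \<open>(y, r)\<close> and at \<open>(y, \<rho> - r)\<close>. The assumed
  orthogonality at \<open>T\<^sub>B\<^sub>,\<^sub>A (u, \<rho>)\<close> reads \<open>g + (\<rho> - r) r = 0\<close>, and so does the required one at \<open>(y, r)\<close>.
\<close>

lemma circumcenter_swap: "circumcenter a b c = circumcenter a c b"
  unfolding circumcenter_def
  by (rule arg_cong[where f = The]) (auto simp: insert_commute)

lemma line_subset_bisector:
  assumes "p = (1/2) *\<^sub>R (y + z)" and "g \<bullet> (y - z) = 0"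
  shows "range (\<lambda>t. p + t *\<^sub>R g) \<subseteq> bisector y z"
  using assms
  by (auto simp: bisector_def orthogonal_comp_def orthogonal_def inner_commute)

text \<open>Valid for arbitrary sets \<open>A\<close> and \<open>B\<close>, so it serves both halves
  of the theorem. The point \<open>T x\<close> is the midpoint of \<open>x\<close> and its double
  reflection, and the projection of \<open>x\<close> onto \<open>A\<close> is the midpoint of
  \<open>x\<close> and \<open>reflector A x\<close>. Each line condition thus amounts to one
  orthogonality relation for \<open>G\<close>.\<close>

lemma circumcentered_reflection_in_MCS:
  assumes lyap: "smooth_lyapunov U (douglas_rachford A B) V G"
    and T: "\<And>x. x \<in> U \<Longrightarrow> G (douglas_rachford A B x) \<bullet> (x - douglas_rachford A B x) = 0"
    and PU: "\<And>x. x \<in> U \<Longrightarrow> closest_point A x \<in> U"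
    and P: "\<And>x. x \<in> U \<Longrightarrow> G (closest_point A x) \<bullet> (x - closest_point A x) = 0"
  shows "circumcentered_reflection A B
           \<in> MCS U (douglas_rachford A B) V G (reflector A) (closest_point A)"
proof -
  have main: "circumcentered_reflection A B x =
        (if \<not> collinear {x, 2 *\<^sub>R douglas_rachford A B x - x, reflector A x}
         then circumcenter x (2 *\<^sub>R douglas_rachford A B x - x) (reflector A x) else douglas_rachford A B x) \<and>
      closest_point A x \<in> U \<and>
      closest_point A x \<in> bisector x (reflector A x) \<inter> affine hull {x, 2 *\<^sub>R douglas_rachford A B x - x, reflector A x} \<and>
      range (\<lambda>t. douglas_rachford A B x + t *\<^sub>R G (douglas_rachford A B x)) \<subseteq> bisector x (2 *\<^sub>R douglas_rachford A B x - x) \<and>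
      range (\<lambda>t. closest_point A x + t *\<^sub>R G (closest_point A x)) \<subseteq> bisector (reflector A x) x"
    (is "?a \<and> ?b \<and> ?c \<and> ?d \<and> ?e")
    if x: "x \<in> U" for x
  proof (intro conjI)
    have TR: "2 *\<^sub>R douglas_rachford A B x - x = reflector B (reflector A x)"
      by (simp add: douglas_rachford_def scaleR_add_right)
    \<comment> \<open>\<open>MCS\<close> lists the simple reflection last, the circumcentered
      operator lists it second.\<close>
    show ?a
      unfolding TR circumcentered_reflection_def
      using circumcenter_swap by (auto simp: insert_commute)
    show ?b by (rule PU[OF x])
    have mid: "closest_point A x = (1/2) *\<^sub>R (x + reflector A x)"
      by (simp add: reflector_def)
    have ort: "G (closest_point A x) \<bullet> (x - reflector A x) = 0"
      using P[OF x] by (simp add: reflector_def inner_diff_right inner_add_right)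
    have 1: "range (\<lambda>t. closest_point A x + t *\<^sub>R G (closest_point A x)) \<subseteq> bisector x (reflector A x)"
      by (rule line_subset_bisector[OF mid ort])
    \<comment> \<open>The parameter 0 picks the base point of the line, so the midpoint itself lies
      on the bisector.\<close>
    have "closest_point A x + 0 *\<^sub>R G (closest_point A x) \<in> bisector x (reflector A x)"
      using 1 by blast
    moreover have "(1/2) *\<^sub>R x + (1/2) *\<^sub>R reflector A x \<in> affine hull {x, 2 *\<^sub>R douglas_rachford A B x - x, reflector A x}"
      by (rule mem_affine) (auto intro: hull_inc)
    ultimately show ?c
      using mid by (simp add: scaleR_add_right)
    show ?d
      using T[OF x] by (intro line_subset_bisector) (auto simp: inner_diff_right algebra_simps)
    show ?e
      using mid ort by (intro line_subset_bisector) (auto simp: inner_diff_right add.commute)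
  qed
  show ?thesis
    unfolding MCS_def using lyap main by blast
qed

text \<open>\<open>U\<close> may have empty interior, so \<open>G\<close> is tested only along
  segments from \<open>p\<close> that remain in \<open>U\<close>; convexity supplies them.\<close>

lemma has_gradient_on_segment:
  assumes "has_gradient_on V G U" and "convex U" and "p \<in> U" and "p + v \<in> U"
  shows "((\<lambda>t. V (p + t *\<^sub>R v)) has_vector_derivative G p \<bullet> v) (at 0 within {0..1})"
proof -
  have sub: "(\<lambda>t. p + t *\<^sub>R v) ` {0..1} \<subseteq> U"
  proof clarsimp
    fix t :: real assume "0 \<le> t" "t \<le> 1"
    then have "(1 - t) *\<^sub>R p + t *\<^sub>R (p + v) \<in> U"
      using assms(2-4) by (simp add: convex_alt)
    then show "p + t *\<^sub>R v \<in> U"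
      by (simp add: algebra_simps)
  qed
  have "(V has_derivative (\<lambda>h. G p \<bullet> h)) (at (p + 0 *\<^sub>R v) within (\<lambda>t. p + t *\<^sub>R v) ` {0..1})"
    using assms(1,3) sub by (auto simp: has_gradient_on_def intro: has_derivative_subset)
  moreover have "((\<lambda>t. p + t *\<^sub>R v) has_derivative (\<lambda>t. t *\<^sub>R v)) (at 0 within {0..1})"
    by (auto intro!: derivative_eq_intros)
  ultimately have "((\<lambda>t. V (p + t *\<^sub>R v)) has_derivative (\<lambda>t. G p \<bullet> (t *\<^sub>R v))) (at 0 within {0..1})"
    using has_derivative_in_compose by fastforce
  then show ?thesis
    by (simp add: has_vector_derivative_def)
qed

text \<open>One-sided derivatives at an endpoint of a nondegenerate interval are unique.
  Differentiating \<open>V\<close> along a segment in two ways therefore yields an identity for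
  \<open>G\<close>.\<close>

lemma vector_derivative_unique_at_0_segment:
  assumes "(h has_vector_derivative a) (at (0::real) within {0..1})"
    and "(h has_vector_derivative b) (at 0 within {0..1})"
  shows "a = b"
  using assms by (auto intro!: vector_derivative_unique_within_closed_interval[of 0 1 0])

lemma closest_point_horizontal:
  fixes x :: "'a::{real_inner,heine_borel} \<times> real"
  shows "closest_point (UNIV \<times> {0}) x = (fst x, 0)"
proof (rule closest_point_unique[symmetric])
  show "convex ((UNIV :: 'a set) \<times> {0 :: real})"
    by (intro convex_Times) auto
  show "closed ((UNIV :: 'a set) \<times> {0 :: real})"
    by (intro closed_Times) auto
  show "\<forall>z\<in>(UNIV :: 'a set) \<times> {0 :: real}. dist x (fst x, 0) \<le> dist x z"
    by (auto simp: dist_prod_def)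
qed auto

theorem corollary2:
  fixes f F :: "'a::{real_inner,heine_borel} \<Rightarrow> ereal"
    and D :: "'a set"
    and A B U :: "('a \<times> real) set"
    and V :: "'a \<times> real \<Rightarrow> real"
    and G :: "'a \<times> real \<Rightarrow> 'a \<times> real"
  assumes "proper f" and "closed (gra f)"
    and "B = gra f" and "A = UNIV \<times> {0}"
    and "D \<subseteq> edom f" and "D \<noteq> {}" and "convex D"
    and "\<exists>L. L-lipschitz_on D (\<lambda>y. real_of_ereal (f y))"
    and "\<And>y. y \<in> D \<Longrightarrow> F y \<noteq> -\<infinity>" and "convex_on_ereal D F"
    and "\<And>y. y \<in> D \<Longrightarrow>
           convex_subdiff D F y \<supseteq>
             (if 0 \<notin> symmetric_subdiff f y
              then {(real_of_ereal (f y) / (norm y')\<^sup>2) *\<^sub>R y' | y'. y' \<in> symmetric_subdiff f y}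
              else if f y = 0 then {0} else {})"
    and "U = D \<times> UNIV"
    and "\<And>y \<rho>. y \<in> D \<Longrightarrow> ereal (V (y, \<rho>)) = F y + ereal (\<rho>\<^sup>2 / 2)"
    and "\<And>y. y \<in> D \<Longrightarrow> 0 \<in> symmetric_subdiff f y \<Longrightarrow> f y = 0"
    and "\<And>x. x \<in> U \<Longrightarrow> \<exists>!p. p \<in> B \<and> (\<forall>q\<in>B. dist x p \<le> dist x q)"
    and "douglas_rachford A B ` U \<subseteq> U"
  shows "(smooth_lyapunov U (douglas_rachford A B) V G \<and>
          (\<forall>x\<in>U. G (douglas_rachford A B x) \<bullet> (x - douglas_rachford A B x) = 0) \<longrightarrow>
            circumcentered_reflection A B
              \<in> MCS U (douglas_rachford A B) V G (reflector A) (closest_point A)) \<and>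
         (smooth_lyapunov U (douglas_rachford B A) V G \<and>
          (\<forall>x\<in>U. G (douglas_rachford B A x) \<bullet> (x - douglas_rachford B A x) = 0) \<longrightarrow>
            circumcentered_reflection B A
              \<in> MCS U (douglas_rachford B A) V G (reflector B) (closest_point B))"
proof -
  have cU: "convex U"
    using assms(7,12) by (simp add: convex_Times)
  \<comment> \<open>The sum of \<open>F y\<close> and a real is real, so \<open>F\<close> is finite
    on \<open>D\<close> and cancels.\<close>
  have V: "V (y, \<rho>) = V (y, 0) + \<rho>\<^sup>2 / 2" if "y \<in> D" for y \<rho>
    using assms(13)[OF that, of \<rho>] assms(13)[OF that, of 0] by (cases "F y") auto
  have PA: "closest_point A x = (fst x, 0)" for x
    unfolding assms(4) by (rule closest_point_horizontal)
  have RA: "reflector A x = (fst x, - snd x)" for x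
    by (simp add: reflector_def PA prod_eq_iff scaleR_2)
  \<comment> \<open>Invariance of \<open>U\<close> under \<open>douglas_rachford A B\<close> is
    applied at \<open>reflector A x\<close>. As \<open>reflector A\<close> is an involution that
    keeps first components, the first component of the image is that of the projection of
    \<open>x\<close> onto \<open>B\<close>.\<close>
  have PB: "fst (closest_point B x) \<in> D" if "x \<in> U" for x
  proof -
    have "reflector A x \<in> U"
      using that assms(12) by (auto simp: RA)
    then have "douglas_rachford A B (reflector A x) \<in> U"
      using assms(16) by blast
    moreover have "reflector A (reflector A x) = x"
      by (simp add: RA)
    moreover have "fst (douglas_rachford A B (reflector A x)) = fst (closest_point B x)"
      using calculation by (simp add: douglas_rachford_def reflector_def[of B] RA scaleR_diff_right)
    ultimately show ?thesis
      using assms(12) by (metis mem_Times_iff)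
  qed
  \<comment> \<open>Vertical segments never leave \<open>U\<close>, so this component of
    \<open>G\<close> is fully determined.\<close>
  have G2: "snd (G (y, s)) = s" if "has_gradient_on V G U" "y \<in> D" for y s
  proof (rule vector_derivative_unique_at_0_segment)
    have "((\<lambda>t. V ((y, s) + t *\<^sub>R (0, 1))) has_vector_derivative G (y, s) \<bullet> (0, 1)) (at 0 within {0..1})"
      using that by (intro has_gradient_on_segment[OF _ cU]) (auto simp: assms(12))
    then show "((\<lambda>t. V (y, s + t)) has_vector_derivative snd (G (y, s))) (at 0 within {0..1})"
      by (simp add: inner_prod_def)
    have "((\<lambda>t. V (y, 0) + (s + t)\<^sup>2 / 2) has_vector_derivative s) (at 0 within {0..1})"
      unfolding has_real_derivative_iff_has_vector_derivative[symmetric]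
      by (auto intro!: derivative_eq_intros)
    then show "((\<lambda>t. V (y, s + t)) has_vector_derivative s) (at 0 within {0..1})"
      by (subst V[OF that(2)])
  qed
  \<comment> \<open>Only directions pointing from \<open>y\<close> to another point of
    \<open>D\<close> can be compared. Along them the restrictions of \<open>V\<close> to two heights
    differ by a constant.\<close>
  have G1: "fst (G (y, s)) \<bullet> (u - y) = fst (G (y, s')) \<bullet> (u - y)"
    if g: "has_gradient_on V G U" and y: "y \<in> D" and u: "u \<in> D" for y u s s'
  proof (rule vector_derivative_unique_at_0_segment)
    have *: "((\<lambda>t. V (y + t *\<^sub>R (u - y), s)) has_vector_derivative fst (G (y, s)) \<bullet> (u - y))
        (at 0 within {0..1})" for s
    proof -
      have "((\<lambda>t. V ((y, s) + t *\<^sub>R (u - y, 0))) has_vector_derivative G (y, s) \<bullet> (u - y, 0))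
          (at 0 within {0..1})"
        using y u by (intro has_gradient_on_segment[OF g cU]) (auto simp: assms(12))
      then show ?thesis
        by (simp add: inner_prod_def)
    qed
    show "((\<lambda>t. V (y + t *\<^sub>R (u - y), s)) has_vector_derivative fst (G (y, s)) \<bullet> (u - y))
        (at 0 within {0..1})"
      by (rule *)
    have seg: "y + t *\<^sub>R (u - y) \<in> D" if "t \<in> {0..1}" for t
    proof -
      have "(1 - t) *\<^sub>R y + t *\<^sub>R u \<in> D"
        using that assms(7) y u by (simp add: convex_alt)
      then show ?thesis
        by (simp add: algebra_simps)
    qed
    have "((\<lambda>t. V (y + t *\<^sub>R (u - y), s') + (s\<^sup>2 / 2 - s'\<^sup>2 / 2)) has_vector_derivative
        fst (G (y, s')) \<bullet> (u - y) + 0) (at 0 within {0..1})"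
      by (intro has_vector_derivative_add * has_vector_derivative_const)
    then show "((\<lambda>t. V (y + t *\<^sub>R (u - y), s)) has_vector_derivative fst (G (y, s')) \<bullet> (u - y))
        (at 0 within {0..1})"
      unfolding add_0_right
    proof (rule has_vector_derivative_transform[rotated 2])
      show "V (y + t *\<^sub>R (u - y), s) = V (y + t *\<^sub>R (u - y), s') + (s\<^sup>2 / 2 - s'\<^sup>2 / 2)"
        if "t \<in> {0..1}" for t
        using V[OF seg[OF that], of s] V[OF seg[OF that], of s'] by simp
    qed simp
  qed
  show ?thesis
  proof (intro conjI impI; elim conjE)
    assume L: "smooth_lyapunov U (douglas_rachford A B) V G"
      and O: "\<forall>x\<in>U. G (douglas_rachford A B x) \<bullet> (x - douglas_rachford A B x) = 0"
    have g: "has_gradient_on V G U"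
      using L by (simp add: smooth_lyapunov_def)
    show "circumcentered_reflection A B
        \<in> MCS U (douglas_rachford A B) V G (reflector A) (closest_point A)"
    proof (rule circumcentered_reflection_in_MCS[OF L])
      fix x assume x: "x \<in> U"
      show "G (douglas_rachford A B x) \<bullet> (x - douglas_rachford A B x) = 0"
        using O x by blast
      show "closest_point A x \<in> U"
        using x by (auto simp: PA assms(12))
      \<comment> \<open>The displacement is vertical and the projection has height 0, where
        \<open>G2\<close> gives 0.\<close>
      show "G (closest_point A x) \<bullet> (x - closest_point A x) = 0"
        using x G2[OF g, of "fst x" 0] by (auto simp: PA assms(12) inner_prod_def)
    qed
  next
    assume L: "smooth_lyapunov U (douglas_rachford B A) V G"
      and O: "\<forall>x\<in>U. G (douglas_rachford B A x) \<bullet> (x - douglas_rachford B A x) = 0"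
    have g: "has_gradient_on V G U"
      using L by (simp add: smooth_lyapunov_def)
    show "circumcentered_reflection B A
        \<in> MCS U (douglas_rachford B A) V G (reflector B) (closest_point B)"
    proof (rule circumcentered_reflection_in_MCS[OF L])
      fix x assume x: "x \<in> U"
      show T: "G (douglas_rachford B A x) \<bullet> (x - douglas_rachford B A x) = 0"
        using O x by blast
      show "closest_point B x \<in> U"
        using PB[OF x] by (simp add: assms(12) mem_Times_iff)
      obtain u \<rho> where u: "x = (u, \<rho>)" "u \<in> D"
        using x assms(12) by auto
      obtain y r where y: "closest_point B x = (y, r)"
        by fastforce
      have yD: "y \<in> D"
        using PB[OF x] y by simp
      \<comment> \<open>Reflecting in \<open>B\<close> gives \<open>(2 y - u, 2 r - \<rho>)\<close>;
        reflecting in \<open>A\<close> flips the height, and averaging with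
        \<open>(u, \<rho>)\<close> gives the claim.\<close>
      have Tx: "douglas_rachford B A x = (y, \<rho> - r)"
        by (simp add: douglas_rachford_def RA reflector_def[of B] y[unfolded u] u prod_eq_iff scaleR_diff_right field_simps)
      have "fst (G (y, r)) \<bullet> (u - y) + (\<rho> - r) * r = 0"
        using T G1[OF g yD u(2), of "\<rho> - r" r] G2[OF g yD, of "\<rho> - r"]
        by (simp add: Tx[unfolded u] u inner_prod_def)
      then show "G (closest_point B x) \<bullet> (x - closest_point B x) = 0"
        using G2[OF g yD, of r] by (simp add: y[unfolded u] u inner_prod_def algebra_simps)
    qed
  qed
qed

end
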